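(* For $q$ even, the generating function of the sequence $\{c_{q,2n/q}\}_{n}$ is given by $$G_q(t):=\sum_{n\ge 0}t^n c_{q,2n/q}=\left(1-\frac{2}{q}\,\frac{u+2u^2+\cdots+qu^q}{1+u+u^2+\cdots+u^q}\right)^{-1}=\frac{q}{2}\,\frac{1+\sum_{k=1}^{q/2}\left(u^{-k}+u^k\right)}{\sum_{k=1}^{q/2}k\left(u^{-k}-u^k\right)},$$ where $u$ is a solution of the equation $$t=u\left(\frac{q+1}{1+u+u^2+\cdots+u^q}\right)^{2/q}=\left(\frac{q+1}{1+\sum_{k=1}^{q/2}\left(u^{-k}+u^k\right)}\right)^{2/q}.$$
   Context: Here $q$ is a positive integer. For $z\in\mathbb{C}$ and an integer $k\ge 0$, the generalized ordinary multinomial is $$\binom{z}{k}_q:=\sum_{k_1+k_2+\cdots+k_q=k}\frac{z(z-1)\cdots(z-k_1+1)}{(k_1-k_2)!\,(k_2-k_3)!\cdots(k_{q-1}-k_q)!\,k_q!},$$ the sum running over nonnegative integers $k_1,\ldots,k_q$ with sum $k$, where a term is $0$ as soon as some $k_i<k_{i+1}$, and the numerator is $1$ when $k_1=0$. For even $q$ and integer $n\ge0$, $c_{q,2n/q}:=(q+1)^{-2n/q}\binom{2n/q}{n}_q$. This extends to $L=2n/q$ the quantity $c_{q,L}=\frac{1}{(q+1)^L}\binom{L}{\lfloor (qL+1)/2\rfloor}_q$, which for integer $L$ is the maximal probability of the $L$-th convolution power of the discrete uniform distribution on $\{0,1,\ldots,q\}$. *)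

theory Defs
  imports "HOL-Complex_Analysis.Complex_Analysis"
begin

text \<open>The tuple \<open>k\<^sub>1, \<dots>, k\<^sub>q\<close> is a list of length \<open>q\<close>, so \<open>k\<^sub>i\<close> is \<open>ks ! (i - 1)\<close>.
  The \<open>if\<close> guards the truncated subtraction of natural numbers. Only \<open>q > 0\<close> is meaningful.\<close>

definition gen_multinomial :: "nat \<Rightarrow> complex \<Rightarrow> nat \<Rightarrow> complex" where
  "gen_multinomial q z k =
     (\<Sum>ks | length ks = q \<and> sum_list ks = k.
        if \<exists>i. Suc i < q \<and> ks ! i < ks ! Suc i then 0
        else (\<Prod>i<ks ! 0. z - of_nat i) /
             ((\<Prod>i<q - 1. fact (ks ! i - ks ! Suc i)) * fact (ks ! (q - 1))))"

text \<open>\<open>c_seq q n\<close> is the number written \<open>c\<close> with indices \<open>q\<close> and \<open>L = 2n/q\<close>.\<close>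

definition c_seq :: "nat \<Rightarrow> nat \<Rightarrow> complex" where
  "c_seq q n = of_nat (q + 1) powr (- (2 * of_nat n / of_nat q)) *
               gen_multinomial q (2 * of_nat n / of_nat q) n"

definition G :: "nat \<Rightarrow> complex \<Rightarrow> complex" where
  "G q t = (\<Sum>n. t ^ n * c_seq q n)"

text \<open>All values of the multivalued power \<open>w\<^sup>a\<close>; the value \<open>w powr a\<close> of the library
  is the one given by the principal logarithm.\<close>

definition power_values :: "complex \<Rightarrow> complex \<Rightarrow> complex set" where
  "power_values w a = {exp (a * l) | l. exp l = w}"

end

theory Submission
  imports Defs
begin

text \<open>Let \<open>S(w) = 1 + w + \<dots> + w\<^sup>q\<close> and \<open>\<phi>(w) = (S(w)/(q+1))\<close> to the power \<open>2/q\<close>. On the unit disc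
  \<open>S\<close> avoids the nonpositive reals, because \<open>1 - w\<close> and \<open>1 - w\<^bsup>q+1\<^esup>\<close> have positive real part,
  so the principal power \<open>\<phi>\<close> is holomorphic there, and \<open>|\<phi>| \<le> 1\<close>. The equation for \<open>u\<close> reads
  \<open>u = t \<phi>(u)\<close>, which by Rouche's theorem has exactly one, simple, solution when \<open>|t| < 1\<close>.
  Nesting \<open>S\<^sub>q = 1 + w S\<^bsub>q-1\<^esub>\<close> and expanding binomially identifies \<open>c\<^bsub>q,2n/q\<^esub>\<close> with the coefficient
  of \<open>w\<^sup>n\<close> in \<open>\<phi>\<^sup>n\<close>, so the Lagrange formula gives the sum \<open>1/(1 - t \<phi>'(u))\<close>.\<close>

section \<open>Fixed points of \<open>t * \<phi>\<close> in the unit disc and the Lagrange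
  series\<close>

text \<open>Rouche's theorem compares \<open>w - t * \<phi> w\<close> with \<open>w\<close> on a
  circle of radius between \<open>norm t\<close> and 1: the orders of the zeros in the disc add up
  to 1. So there is one zero, and its order 1 makes the derivative there nonzero.\<close>

lemma fixed_point_simple:
  fixes \<phi> :: "complex \<Rightarrow> complex"
  assumes holo: "\<phi> holomorphic_on ball 0 1"
    and le: "\<And>w. norm w < 1 \<Longrightarrow> norm (\<phi> w) \<le> 1"
    and t: "norm t < 1"
  obtains u where "norm u < 1" "u = t * \<phi> u"
    "\<And>v. norm v < 1 \<Longrightarrow> v = t * \<phi> v \<Longrightarrow> v = u" "1 - t * deriv \<phi> u \<noteq> 0"
proof -
  define r where "r = (1 + norm t) / 2"
  have r: "norm t < r" "r < 1" "0 < r"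
    using t norm_ge_zero[of t] by (auto simp: r_def simp del: norm_ge_zero)
  define F where "F = (\<lambda>w. w + - t * \<phi> w)"
  define Z where "Z = {w \<in> ball 0 1. F w = 0}"
  have tphi: "norm (- t * \<phi> w) \<le> norm t" if "norm w < 1" for w
    using le[OF that] mult_left_mono[of "norm (\<phi> w)" 1 "norm t"] by (simp add: norm_mult)
  have F_holo: "F holomorphic_on ball 0 1"
    unfolding F_def by (intro holomorphic_intros holo)
  \<comment> \<open>A zero satisfies \<open>norm w = norm (t * \<phi> w) \<le> norm t < r\<close>,
    so the circle of radius \<open>r\<close> winds once around each zero.\<close>
  have Z_le: "norm w < r" if "w \<in> Z" for w
  proof -
    have "w = - (- t * \<phi> w)" using that by (simp add: Z_def F_def add_eq_0_iff)
    then have "norm w = norm (- t * \<phi> w)" by (metis norm_minus_cancel)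
    then show ?thesis using tphi[of w] r that by (simp add: Z_def)
  qed
  have F_nz: "F w \<noteq> 0" if "norm w < 1" "r \<le> norm w" for w
    using that Z_le[of w] by (auto simp: Z_def)
  have finZ: "finite Z"
  proof (cases "F constant_on ball 0 1")
    case True
    then obtain c where c: "\<And>w. w \<in> ball 0 1 \<Longrightarrow> F w = c" by (auto simp: constant_on_def)
    have "c \<noteq> 0" using c[of "of_real r"] F_nz[of "of_real r"] r by auto
    then have "Z = {}" using c by (auto simp: Z_def)
    then show ?thesis by simp
  next
    case False
    have "finite {w \<in> cball 0 r. F w = 0}"
      by (rule holomorphic_compact_finite_zeros[OF F_holo _ _ _ _ False]) (use r in auto)
    moreover have "Z \<subseteq> {w \<in> cball 0 r. F w = 0}"
      using Z_le by (fastforce simp: Z_def)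
    ultimately show ?thesis by (rule rev_finite_subset)
  qed
  have wn: "winding_number (circlepath 0 r) w = 1" if "norm w < r" for w
    using that by (intro winding_number_circlepath) simp
  have Z0: "{p \<in> ball 0 1. p = 0} = {0::complex}" by auto
  have "(\<Sum>p\<in>Z. winding_number (circlepath 0 r) p * zorder F p) =
        (\<Sum>p\<in>{p \<in> ball 0 1. p = 0}. winding_number (circlepath 0 r) p * zorder (\<lambda>p. p) p)"
    unfolding Z_def F_def
  proof (rule Rouche_theorem)
    show "finite {p \<in> ball 0 1. p + - t * \<phi> p = 0}" using finZ by (simp add: Z_def F_def)
    show "path_image (circlepath 0 r) \<subseteq> ball 0 1" using r by auto
    show "\<forall>z\<in>path_image (circlepath 0 r). cmod (- t * \<phi> z) < cmod z"
    proof
      fix z assume "z \<in> path_image (circlepath 0 r)"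
      then have "norm z = r" using r by simp
      then show "cmod (- t * \<phi> z) < cmod z" using tphi[of z] r by simp
    qed
    show "\<forall>z. z \<notin> ball 0 1 \<longrightarrow> winding_number (circlepath 0 r) z = 0"
    proof (intro allI impI)
      fix z :: complex assume "z \<notin> ball 0 1"
      then show "winding_number (circlepath 0 r) z = 0"
        using r by (intro winding_number_zero_outside[of _ "cball 0 r"]) auto
    qed
  qed (auto simp: Z0 intro!: holomorphic_intros holo)
  also have "\<dots> = 1"
    using wn[of 0] r simple_zeroI[of UNIV 0 "\<lambda>_. 1" "\<lambda>p. p"] unfolding Z0 by simp
  also have "(\<Sum>p\<in>Z. winding_number (circlepath 0 r) p * zorder F p) = (\<Sum>p\<in>Z. of_int (zorder F p))"
    by (intro sum.cong refl) (use wn Z_le in simp)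
  also have "\<dots> = of_int (\<Sum>p\<in>Z. zorder F p)" by simp
  finally have sum1: "(\<Sum>p\<in>Z. zorder F p) = 1" by (metis of_int_eq_1_iff)
  have ex: "\<exists>w\<in>ball 0 1. F w \<noteq> 0"
    using F_nz[of "of_real r"] r by (intro bexI[of _ "of_real r"]) auto
  have zo: "zorder F p > 0 \<and> (\<exists>e>0. cball p e \<subseteq> ball 0 1 \<and> zor_poly F p holomorphic_on cball p e \<and>
      (\<forall>w\<in>cball p e. F w = zor_poly F p w * (w - p) ^ nat (zorder F p) \<and> zor_poly F p w \<noteq> 0))"
    if "p \<in> Z" for p
    using zorder_exist_zero[OF F_holo _ _ _ ex, of p] that by (simp add: Z_def)
  have "Z \<noteq> {}" using sum1 by auto
  then obtain u where u: "u \<in> Z" by auto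
  have split: "(\<Sum>p\<in>Z. zorder F p) = zorder F u + (\<Sum>p\<in>Z - {u}. zorder F p)"
    by (rule sum.remove[OF finZ u])
  \<comment> \<open>All orders are at least 1 and their total is 1, which leaves no room for a
    second zero or for order 2.\<close>
  have ge: "(\<Sum>p\<in>Z - {u}. zorder F p) \<ge> int (card (Z - {u}))"
    using sum_mono[of "Z - {u}" "\<lambda>_. 1" "zorder F"] zo by fastforce
  have ord: "zorder F u = 1" and "card (Z - {u}) = 0"
    using split ge sum1 zo[OF u] by auto
  then have "Z - {u} = {}" using finZ by (metis card_0_eq finite_Diff)
  then have Zu: "Z = {u}" using u by blast
  \<comment> \<open>Order 1 gives \<open>F w = g w * (w - u)\<close> near \<open>u\<close> with
    \<open>g u \<noteq> 0\<close>; differentiating the product at \<open>u\<close> yields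
    \<open>g u\<close>.\<close>
  obtain e where e: "e > 0" "zor_poly F u holomorphic_on cball u e"
    "\<And>w. w \<in> cball u e \<Longrightarrow> F w = zor_poly F u w * (w - u)" "zor_poly F u u \<noteq> 0"
  proof -
    obtain e where "e > 0" "zor_poly F u holomorphic_on cball u e"
      "\<forall>w\<in>cball u e. F w = zor_poly F u w * (w - u) ^ nat (zorder F u) \<and> zor_poly F u w \<noteq> 0"
      using zo[OF u] by blast
    then show ?thesis by (intro that[of e]) (simp_all add: ord)
  qed
  have "(zor_poly F u has_field_derivative deriv (zor_poly F u) u) (at u)"
    using e by (intro holomorphic_derivI[of _ "ball u e"])
      (auto intro: holomorphic_on_subset)
  then have "((\<lambda>w. zor_poly F u w * (w - u)) has_field_derivative zor_poly F u u) (at u)"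
    by (auto intro!: derivative_eq_intros)
  moreover have "eventually (\<lambda>w. zor_poly F u w * (w - u) = F w) (nhds u)"
    using eventually_nhds_in_open[of "ball u e" u] e by (auto elim!: eventually_mono)
  ultimately have "(F has_field_derivative zor_poly F u u) (at u)"
    by (rule DERIV_cong_ev[OF refl _ refl, THEN iffD1, rotated])
  moreover have "(\<phi> has_field_derivative deriv \<phi> u) (at u)"
    using u by (intro holomorphic_derivI[OF holo]) (auto simp: Z_def)
  then have "(F has_field_derivative 1 - t * deriv \<phi> u) (at u)"
    unfolding F_def by (auto intro!: derivative_eq_intros)
  ultimately have "1 - t * deriv \<phi> u = zor_poly F u u" by (rule DERIV_unique[symmetric])
  then have "1 - t * deriv \<phi> u \<noteq> 0" using e by simp
  moreover have "v = u" if "norm v < 1" "v = t * \<phi> v" for v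
  proof -
    have "v \<in> Z" using that by (simp add: Z_def F_def)
    then show ?thesis using Zu by simp
  qed
  moreover have "norm u < 1" "u = t * \<phi> u" using u by (auto simp: Z_def F_def add_eq_0_iff)
  ultimately show ?thesis by (intro that)
qed

text \<open>On the circle of radius \<open>r\<close>, the partial sums of the series have integrands that add up to
  \<open>1/(w - t \<phi>(w))\<close> up to a geometric remainder; the integral of the limit is \<open>1/(1 - t \<phi>'(u))\<close>
  by Cauchy's formula at the only zero \<open>u\<close> of the denominator.\<close>

lemma lagrange_sums:
  fixes \<phi> :: "complex \<Rightarrow> complex"
  assumes holo: "\<phi> holomorphic_on ball 0 1"
    and le: "\<And>w. norm w < 1 \<Longrightarrow> norm (\<phi> w) \<le> 1"
    and t: "norm t < 1" and u: "norm u < 1" "u = t * \<phi> u"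
  shows "1 - t * deriv \<phi> u \<noteq> 0"
    and "(\<lambda>n. t ^ n * ((deriv ^^ n) (\<lambda>w. \<phi> w ^ n) 0 / fact n)) sums inverse (1 - t * deriv \<phi> u)"
proof -
  obtain u' where u': "u' = t * \<phi> u'"
    "\<And>v. norm v < 1 \<Longrightarrow> v = t * \<phi> v \<Longrightarrow> v = u'" "1 - t * deriv \<phi> u' \<noteq> 0"
    using fixed_point_simple[OF holo le t] by metis
  have "u = u'" using u u' by blast
  then have uniq: "v = u" if "norm v < 1" "v = t * \<phi> v" for v
    using that u' by blast
  show nz: "1 - t * deriv \<phi> u \<noteq> 0" using u' \<open>u = u'\<close> by simp
  define r where "r = (1 + norm t) / 2"
  have r: "norm t < r" "r < 1" "0 < r"
    using t norm_ge_zero[of t] by (auto simp: r_def simp del: norm_ge_zero)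
  define F where "F = (\<lambda>w. w - t * \<phi> w)"
  have tphi: "norm (t * \<phi> w) \<le> norm t" if "norm w < 1" for w
    using le[OF that] mult_left_mono[of "norm (\<phi> w)" 1 "norm t"] by (simp add: norm_mult)
  have ur: "norm u < r" using tphi[of u] u r by simp
  have F_holo: "F holomorphic_on ball 0 1"
    unfolding F_def by (intro holomorphic_intros holo)
  have Fu: "F u = 0" using u by (simp add: F_def)
  have "(\<phi> has_field_derivative deriv \<phi> u) (at u)"
    using u by (intro holomorphic_derivI[OF holo]) auto
  then have "(F has_field_derivative 1 - t * deriv \<phi> u) (at u)"
    unfolding F_def by (auto intro!: derivative_eq_intros)
  then have dF: "deriv F u = 1 - t * deriv \<phi> u" by (rule DERIV_imp_deriv)
  \<comment> \<open>The removable singularity is filled with the derivative. As \<open>u\<close> is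
    the only zero of \<open>F\<close> in the disc and is simple, \<open>h\<close> has no zero there,
    and \<open>1 / F w = inverse (h w) / (w - u)\<close> suits Cauchy's formula.\<close>
  define h where "h = (\<lambda>w. if w = u then deriv F u else (F w - F u) / (w - u))"
  have h_holo: "h holomorphic_on ball 0 1"
    unfolding h_def using u by (intro pole_lemma[OF F_holo]) (auto simp: interior_open)
  have Fh: "F w = h w * (w - u)" for w by (simp add: h_def Fu)
  have h_nz: "h w \<noteq> 0" if "norm w < 1" for w
  proof (cases "w = u")
    case True
    then show ?thesis using nz by (simp add: h_def dF)
  next
    case False
    then have "F w \<noteq> 0" using uniq[OF that] unfolding F_def by (metis eq_iff_diff_eq_0)
    then show ?thesis using False by (simp add: h_def Fu)
  qed
  have "((\<lambda>w. inverse (h w) / (w - u)) has_contour_integral 2 * of_real pi * \<i> * inverse (h u)) (circlepath 0 r)"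
    using h_nz r ur
    by (intro Cauchy_integral_circlepath_simple holomorphic_intros holomorphic_on_subset[OF h_holo]) auto
  then have I: "((\<lambda>w. 1 / F w) has_contour_integral 2 * of_real pi * \<i> * inverse (1 - t * deriv \<phi> u)) (circlepath 0 r)"
    unfolding Fh by (simp add: h_def dF field_simps)
  define a where "a = (\<lambda>n. t ^ n * ((deriv ^^ n) (\<lambda>w. \<phi> w ^ n) 0 / fact n))"
  have C: "((\<lambda>w. \<phi> w ^ n / (w - 0) ^ Suc n) has_contour_integral
      of_real (2 * pi) * \<i> / fact n * (deriv ^^ n) (\<lambda>w. \<phi> w ^ n) 0) (circlepath 0 r)" for n
  proof (rule Cauchy_has_contour_integral_higher_derivative_circlepath)
    show "continuous_on (cball 0 r) (\<lambda>w. \<phi> w ^ n)" "(\<lambda>w. \<phi> w ^ n) holomorphic_on ball 0 r"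
      using r by (auto intro!: holomorphic_on_imp_continuous_on holomorphic_intros
          intro: holomorphic_on_subset[OF holo])
  qed (use r in auto)
  have A: "((\<lambda>w. t ^ n * (\<phi> w ^ n / w ^ Suc n)) has_contour_integral 2 * of_real pi * \<i> * a n) (circlepath 0 r)" for n
    using has_contour_integral_lmul[OF C[of n], of "t ^ n"] by (simp add: a_def mult_ac)
  have R: "((\<lambda>w. 1 / F w - (\<Sum>n<N. t ^ n * (\<phi> w ^ n / w ^ Suc n))) has_contour_integral
      2 * of_real pi * \<i> * (inverse (1 - t * deriv \<phi> u) - (\<Sum>n<N. a n))) (circlepath 0 r)" for N
    using has_contour_integral_diff[OF I has_contour_integral_sum[OF _ A, of "{..<N}" "\<lambda>n. n"]]
    by (simp add: sum_distrib_left right_diff_distrib)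
  have bd: "norm (1 / F w - (\<Sum>n<N. t ^ n * (\<phi> w ^ n / w ^ Suc n))) \<le> (norm t / r) ^ N / (r - norm t)"
    if w: "norm (w - 0) = r" for w N
  proof -
    have w0: "w \<noteq> 0" using w r by auto
    have w1: "norm w = r" "norm w < 1" using w r by auto
    have "r \<le> norm (F w) + norm (t * \<phi> w)"
      using norm_triangle_ineq[of "F w" "t * \<phi> w"] w1 by (simp add: F_def)
    then have Fw: "r - norm t \<le> norm (F w)" using tphi[OF w1(2)] by simp
    then have F0: "F w \<noteq> 0" using r by auto
    \<comment> \<open>Since \<open>F w = w * (1 - x)\<close>, the sum is a geometric one divided by
      \<open>w\<close>. It misses \<open>1 / F w\<close> by \<open>x ^ N / F w\<close>, where
      \<open>norm x \<le> norm t / r < 1\<close>.\<close>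
    define x where "x = t * \<phi> w / w"
    have Fx: "F w = w * (1 - x)" using w0 by (simp add: F_def x_def field_simps)
    then have x1: "x \<noteq> 1" using F0 by auto
    have "(\<Sum>n<N. t ^ n * (\<phi> w ^ n / w ^ Suc n)) = (\<Sum>n<N. x ^ n) / w"
      unfolding sum_divide_distrib by (intro sum.cong refl) (simp add: x_def power_mult_distrib power_divide)
    also have "(\<Sum>n<N. x ^ n) = (1 - x ^ N) / (1 - x)"
      using x1 by (simp add: sum_gp_strict)
    finally have "1 / F w - (\<Sum>n<N. t ^ n * (\<phi> w ^ n / w ^ Suc n)) = x ^ N / F w"
      using w0 x1 by (simp add: Fx field_simps)
    moreover have "norm x \<le> norm t / r"
      using tphi[OF w1(2)] w1 r by (simp add: x_def norm_divide divide_right_mono)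
    ultimately show ?thesis using Fw r
      by (simp add: norm_divide norm_power) (intro frac_le power_mono, auto)
  qed
  have rem: "norm (inverse (1 - t * deriv \<phi> u) - (\<Sum>n<N. a n)) \<le> (norm t / r) ^ N * (r / (r - norm t))" for N
  proof -
    define X where "X = inverse (1 - t * deriv \<phi> u) - (\<Sum>n<N. a n)"
    have "norm (2 * of_real pi * \<i> * X) \<le> (norm t / r) ^ N / (r - norm t) * (2 * pi * r)"
      unfolding X_def by (rule has_contour_integral_bound_circlepath[OF R _ _ bd]) (use r in auto)
    then have "2 * pi * norm X \<le> 2 * pi * ((norm t / r) ^ N * (r / (r - norm t)))"
      by (simp add: norm_mult mult_ac)
    then have "norm X \<le> (norm t / r) ^ N * (r / (r - norm t))"
      by (rule mult_left_le_imp_le) simp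
    then show ?thesis unfolding X_def .
  qed
  have "(\<lambda>N. (norm t / r) ^ N * (r / (r - norm t))) \<longlonglongrightarrow> 0"
    using r by (intro tendsto_mult_left_zero LIMSEQ_power_zero) auto
  then have "(\<lambda>N. inverse (1 - t * deriv \<phi> u) - (\<Sum>n<N. a n)) \<longlonglongrightarrow> 0"
    by (rule Lim_null_comparison[OF always_eventually[OF allI[OF rem]]])
  from tendsto_diff[OF tendsto_const this, of "inverse (1 - t * deriv \<phi> u)"]
  have "(\<lambda>N. \<Sum>n<N. a n) \<longlonglongrightarrow> inverse (1 - t * deriv \<phi> u)" by simp
  then show "(\<lambda>n. t ^ n * ((deriv ^^ n) (\<lambda>w. \<phi> w ^ n) 0 / fact n)) sums inverse (1 - t * deriv \<phi> u)"
    unfolding sums_def a_def .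
qed

section \<open>Generalized multinomials as power series coefficients\<close>

text \<open>The product of binomials that appears when a power of
  \<open>1 + x * (1 + x * ...)\<close> is expanded from the outside inwards.\<close>

fun choose_chain :: "nat \<Rightarrow> nat list \<Rightarrow> nat" where
  "choose_chain i [] = 1"
| "choose_chain i (k # ks) = (i choose k) * choose_chain k ks"

text \<open>The factorials telescope, because \<open>(k choose j) / k!\<close> equals
  \<open>1 / (j! * (k - j)!)\<close> for \<open>j \<le> k\<close>. The binomial vanishes for
  \<open>k < j\<close>, which accounts for the zero case of the multinomial.\<close>

lemma choose_chain_div_fact:
  "of_nat (choose_chain k ks) / fact k =
     (if \<exists>i. Suc i < length (k # ks) \<and> (k # ks) ! i < (k # ks) ! Suc i then 0
      else 1 / ((\<Prod>i<length ks. fact ((k # ks) ! i - (k # ks) ! Suc i)) * fact ((k # ks) ! length ks))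
      :: 'a :: field_char_0)"
proof (induction ks arbitrary: k)
  case Nil
  then show ?case by simp
next
  case (Cons j ks)
  have ex: "(\<exists>i. Suc i < length (k # j # ks) \<and> (k # j # ks) ! i < (k # j # ks) ! Suc i) \<longleftrightarrow>
     k < j \<or> (\<exists>i. Suc i < length (j # ks) \<and> (j # ks) ! i < (j # ks) ! Suc i)"
    (is "(\<exists>i. ?P i) \<longleftrightarrow> _ \<or> (\<exists>i. ?Q i)")
  proof -
    have "(\<exists>i. ?P i) \<longleftrightarrow> ?P 0 \<or> (\<exists>i. ?P (Suc i))" by (metis not0_implies_Suc)
    then show ?thesis by simp
  qed
  show ?case
  proof (cases "k < j")
    case True
    then show ?thesis unfolding ex by simp
  next
    case False
    then have "of_nat (choose_chain k (j # ks)) / fact k =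
        (of_nat (choose_chain j ks) / fact j) * (1 / fact (k - j) :: 'a)"
      by (simp add: binomial_fact field_simps)
    then show ?thesis unfolding ex Cons.IH using False
      by (simp add: prod.lessThan_Suc_shift del: prod.lessThan_Suc)
  qed
qed

lemma sum_lists_length_Suc:
  fixes f :: "nat list \<Rightarrow> 'a :: comm_monoid_add"
  shows "(\<Sum>ks | length ks = Suc m \<and> sum_list ks = n. f ks) =
         (\<Sum>k\<le>n. \<Sum>ks | length ks = m \<and> sum_list ks = n - k. f (k # ks))"
proof -
  have fin: "finite {ks. length ks = m \<and> sum_list ks = n}" for m n :: nat
  proof (rule finite_subset)
    show "{ks. length ks = m \<and> sum_list ks = n} \<subseteq> {ks. set ks \<subseteq> {..n} \<and> length ks = m}"
      using member_le_sum_list by fastforce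
  qed (rule finite_lists_length_eq, simp)
  have "(\<Sum>k\<le>n. \<Sum>ks | length ks = m \<and> sum_list ks = n - k. f (k # ks)) =
      (\<Sum>(k, ks)\<in>(SIGMA k:{..n}. {ks. length ks = m \<and> sum_list ks = n - k}). f (k # ks))"
    by (rule sum.Sigma) (auto intro: fin)
  also have "\<dots> = (\<Sum>ks | length ks = Suc m \<and> sum_list ks = n. f ks)"
    by (rule sum.reindex_bij_witness[of _ "\<lambda>ks. (hd ks, tl ks)" "\<lambda>(k, ks). k # ks"])
       (auto simp: length_Suc_conv)
  finally show ?thesis ..
qed

lemma geometric_Suc: "(\<Sum>j\<le>Suc m. x ^ j) = 1 + x * (\<Sum>j\<le>m. x ^ j)"
  for x :: "'a :: comm_semiring_1"
  by (simp add: sum.atMost_Suc_shift sum_distrib_left del: sum.atMost_Suc)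

text \<open>Induction by \<open>geometric_Suc\<close> and the binomial theorem: the summation index
  becomes the head of the list, and the inner power supplies the tail.\<close>

lemma fps_geometric_power_nth:
  "((\<Sum>j\<le>m. fps_X ^ j) ^ i :: 'a :: comm_ring_1 fps) $ n =
     of_nat (\<Sum>ks | length ks = m \<and> sum_list ks = n. choose_chain i ks)"
proof (induction m arbitrary: i n)
  case 0
  have "{ks. ks = [] \<and> sum_list ks = n} = (if n = 0 then {[]} else {})" by auto
  then show ?case by simp
next
  case (Suc m)
  let ?S = "(\<Sum>j\<le>m. fps_X ^ j) :: 'a fps"
  have "((\<Sum>j\<le>Suc m. fps_X ^ j) ^ i :: 'a fps) $ n = ((fps_X * ?S + 1) ^ i) $ n"
    by (simp only: geometric_Suc add.commute)
  also have "(fps_X * ?S + 1) ^ i = (\<Sum>k\<le>i. of_nat (i choose k) * (fps_X ^ k * ?S ^ k))"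
    by (simp add: binomial_ring power_mult_distrib)
  also have "\<dots> $ n = (\<Sum>k\<le>i. of_nat (i choose k) * (fps_X ^ k * ?S ^ k) $ n)"
    by (simp add: fps_sum_nth flip: fps_of_nat)
  also have "\<dots> = (\<Sum>k\<le>n. of_nat (i choose k) * (?S ^ k) $ (n - k))"
    \<comment> \<open>The two ranges agree up to zero terms: \<open>fps_X ^ k\<close> kills the
      coefficient when \<open>k > n\<close>, the binomial vanishes when
      \<open>k > i\<close>.\<close>
    by (rule sum.mono_neutral_cong) (auto simp: fps_X_power_mult_nth binomial_eq_0)
  also have "\<dots> = of_nat (\<Sum>ks | length ks = Suc m \<and> sum_list ks = n. choose_chain i ks)"
    by (simp add: Suc.IH sum_lists_length_Suc sum_distrib_left)
  finally show ?case .
qed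

text \<open>The right-hand series is the formal \<open>z\<close>-th power of
  \<open>1 + x + ... + x ^ Suc m\<close>. Only the outermost expansion has the complex exponent
  \<open>z\<close>; all inner ones are natural powers, covered by
  \<open>choose_chain\<close>.\<close>

lemma gen_multinomial_eq_fps_nth:
  "gen_multinomial (Suc m) z n = (fps_binomial z oo fps_X * (\<Sum>j\<le>m. fps_X ^ j)) $ n"
proof -
  let ?S = "(\<Sum>j\<le>m. fps_X ^ j) :: complex fps"
  have "(fps_binomial z oo fps_X * ?S) $ n = (\<Sum>k\<le>n. (z gchoose k) * (?S ^ k) $ (n - k))"
    unfolding fps_compose_nth atLeast0AtMost
    by (intro sum.cong) (simp_all add: power_mult_distrib fps_X_power_mult_nth)
  also have "\<dots> = (\<Sum>k\<le>n. \<Sum>ks | length ks = m \<and> sum_list ks = n - k.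
      (z gchoose k) * of_nat (choose_chain k ks))"
    by (simp add: fps_geometric_power_nth sum_distrib_left)
  also have "\<dots> = gen_multinomial (Suc m) z n"
    unfolding gen_multinomial_def sum_lists_length_Suc
  proof (intro sum.cong refl)
    fix k ks assume "ks \<in> {ks. length ks = m \<and> sum_list ks = n - k}"
    then have m: "m = length ks" by simp
    have "(z gchoose k) * of_nat (choose_chain k ks) =
        (\<Prod>i<k. z - of_nat i) * (of_nat (choose_chain k ks) / fact k)"
      by (simp add: gbinomial_prod_rev atLeast0LessThan)
    then show "(z gchoose k) * of_nat (choose_chain k ks) =
        (if \<exists>i. Suc i < Suc m \<and> (k # ks) ! i < (k # ks) ! Suc i then 0
         else (\<Prod>i<(k # ks) ! 0. z - of_nat i) /
           ((\<Prod>i<Suc m - 1. fact ((k # ks) ! i - (k # ks) ! Suc i)) * fact ((k # ks) ! (Suc m - 1))))"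
      unfolding choose_chain_div_fact m by auto
  qed
  finally show ?thesis ..
qed

lemma higher_deriv_geometric_powr:
  assumes "q > 0"
  shows "(deriv ^^ n) (\<lambda>w. (\<Sum>k=0..q. w ^ k) powr z) 0 / fact n = gen_multinomial q z n"
proof -
  obtain m where q: "q = Suc m" using assms gr0_implies_Suc by blast
  have "((\<lambda>x. (1 + x) powr z) \<circ> (\<lambda>w. w * (\<Sum>j\<le>m. w ^ j))) has_fps_expansion
      (fps_binomial z oo fps_X * (\<Sum>j\<le>m. fps_X ^ j))"
    by (intro has_fps_expansion_compose fps_expansion_intros) simp
  also have "((\<lambda>x. (1 + x) powr z) \<circ> (\<lambda>w. w * (\<Sum>j\<le>m. w ^ j))) = (\<lambda>w. (\<Sum>k=0..q. w ^ k) powr z)"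
    unfolding q atLeast0AtMost geometric_Suc by (simp add: o_def)
  finally show ?thesis
    unfolding q gen_multinomial_eq_fps_nth by (rule fps_nth_fps_expansion[symmetric])
qed

section \<open>The geometric polynomial on the unit disc\<close>

text \<open>Multiplying by \<open>1 - w\<close> gives \<open>1 - w ^ Suc q\<close>. Both have
  positive real part, so a real value of the sum must be positive.\<close>

lemma geometric_notin_nonpos_Reals:
  fixes w :: complex
  assumes "norm w < 1"
  shows "(\<Sum>k=0..q. w ^ k) \<notin> \<real>\<^sub>\<le>\<^sub>0"
proof
  assume "(\<Sum>k=0..q. w ^ k) \<in> \<real>\<^sub>\<le>\<^sub>0"
  then obtain s where s: "s \<le> 0" "(\<Sum>k=0..q. w ^ k) = of_real s"
    by (auto simp: nonpos_Reals_def)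
  have w: "Re w < 1" "Re (w ^ Suc q) < 1"
    using assms complex_Re_le_cmod[of w] complex_Re_le_cmod[of "w ^ Suc q"]
      power_less_one_iff[of "norm w" "Suc q"]
    by (auto simp: norm_power simp del: power_Suc)
  have "1 - w ^ Suc q = (1 - w) * of_real s"
    using sum_gp_basic[of w q] s by (simp add: atLeast0AtMost)
  then have "Re (1 - w ^ Suc q) = Re ((1 - w) * of_real s)" by metis
  then have "1 - Re (w ^ Suc q) = (1 - Re w) * s" by (simp del: power_Suc)
  then show False using w s mult_nonneg_nonpos[of "1 - Re w" s] by linarith
qed

lemma geometric_divide_notin_nonpos_Reals:
  fixes w :: complex
  assumes "norm w < 1"
  shows "(\<Sum>k=0..q. w ^ k) / of_nat (q + 1) \<notin> \<real>\<^sub>\<le>\<^sub>0"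
proof
  assume "(\<Sum>k=0..q. w ^ k) / of_nat (q + 1) \<in> \<real>\<^sub>\<le>\<^sub>0"
  then have "of_nat (q + 1) * ((\<Sum>k=0..q. w ^ k) / of_nat (q + 1)) \<in> \<real>\<^sub>\<le>\<^sub>0"
    by (rule nonpos_Reals_mult_I1[rotated]) simp
  then show False
    using geometric_notin_nonpos_Reals[OF assms, of q]
    by (simp del: of_nat_Suc of_nat_add)
qed

lemma norm_normalized_geometric_le:
  fixes w :: complex
  assumes "norm w < 1" "a \<ge> 0"
  shows "norm (((\<Sum>k=0..q. w ^ k) / of_nat (q + 1)) powr of_real a) \<le> 1"
proof -
  have "norm (\<Sum>k=0..q. w ^ k) \<le> (\<Sum>k=0..q. 1)"
    by (rule sum_norm_le) (use assms in \<open>simp add: norm_power power_le_one\<close>)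
  then have "norm ((\<Sum>k=0..q. w ^ k) / of_nat (q + 1)) \<le> 1"
    by (simp add: norm_divide divide_le_eq del: of_nat_Suc of_nat_add)
  then have "norm ((\<Sum>k=0..q. w ^ k) / of_nat (q + 1)) powr a \<le> 1 powr a"
    using assms by (intro powr_mono2) auto
  then show ?thesis by (simp add: norm_powr_real_powr')
qed

section \<open>Passage to the forms symmetric in \<open>u\<close> and its inverse\<close>

text \<open>Each induction step shifts the old sum by one power and adds the outer pair, which
  contributes the new end terms \<open>1\<close> and \<open>u ^ (2 * p + 2)\<close>.\<close>

lemma power_mult_symmetric_sum:
  fixes u :: "'a :: field_char_0"
  assumes "u \<noteq> 0"
  shows "u ^ p * (1 + (\<Sum>k=1..p. u powi (- int k) + u ^ k)) = (\<Sum>k=0..2*p. u ^ k)"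
proof (induction p)
  case (Suc p)
  have eq: "u ^ Suc p * (u powi (- int (Suc p)) + u ^ Suc p) = 1 + u ^ (2 * p + 2)"
    using assms by (simp add: distrib_left power_int_minus flip: power_add power_Suc of_nat_Suc mult_2)
  have "u ^ Suc p * (1 + (\<Sum>k=1..Suc p. u powi (- int k) + u ^ k)) =
      u * (u ^ p * (1 + (\<Sum>k=1..p. u powi (- int k) + u ^ k)))
      + u ^ Suc p * (u powi (- int (Suc p)) + u ^ Suc p)"
    by (simp add: algebra_simps del: of_nat_Suc)
  also have "\<dots> = u * (\<Sum>k=0..2*p. u ^ k) + (1 + u ^ (2 * p + 2))"
    unfolding Suc.IH eq ..
  also have "\<dots> = (\<Sum>k=0..Suc (2*p). u ^ k) + u ^ (2 * p + 2)"
    unfolding sum.atLeast0_atMost_Suc_shift[of _ "2 * p"] by (simp add: sum_distrib_left)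
  finally show ?case by simp
qed simp

lemma power_mult_antisymmetric_sum:
  fixes u :: "'a :: field_char_0"
  assumes "u \<noteq> 0"
  shows "u ^ p * (\<Sum>k=1..p. of_nat k * (u powi (- int k) - u ^ k)) =
         (\<Sum>k=0..2*p. (of_nat p - of_nat k) * u ^ k)"
proof (induction p)
  case (Suc p)
  have eq: "u ^ Suc p * (u powi (- int (Suc p)) - u ^ Suc p) = 1 - u ^ (2 * p + 2)"
    using assms by (simp add: right_diff_distrib power_int_minus flip: power_add power_Suc of_nat_Suc mult_2)
  have "u ^ Suc p * (\<Sum>k=1..Suc p. of_nat k * (u powi (- int k) - u ^ k)) =
      u * (u ^ p * (\<Sum>k=1..p. of_nat k * (u powi (- int k) - u ^ k)))
      + of_nat (Suc p) * (u ^ Suc p * (u powi (- int (Suc p)) - u ^ Suc p))"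
    by (simp add: algebra_simps del: of_nat_Suc)
  also have "\<dots> = u * (\<Sum>k=0..2*p. (of_nat p - of_nat k) * u ^ k) + of_nat (Suc p) * (1 - u ^ (2 * p + 2))"
    unfolding Suc.IH eq ..
  \<comment> \<open>Shifting \<open>k\<close> by one preserves the weight \<open>p - k\<close> as
    \<open>Suc p - Suc k\<close>. The new end weights are \<open>Suc p\<close> and
    \<open>Suc p - (2 * p + 2)\<close>, that is, its negative.\<close>
  also have "\<dots> = (\<Sum>k=0..Suc (2*p). (of_nat (Suc p) - of_nat k) * u ^ k) - of_nat (Suc p) * u ^ (2 * p + 2)"
    unfolding sum.atLeast0_atMost_Suc_shift[of _ "2 * p"]
    by (simp add: sum_distrib_left algebra_simps)
  finally show ?case by (simp add: algebra_simps)
qed simp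

section \<open>Taylor coefficients and derivative of the normalized power\<close>

lemma higher_deriv_normalized_geometric:
  assumes "q > 0"
  shows "(deriv ^^ n) (\<lambda>w. (((\<Sum>k=0..q. w ^ k) / of_nat (q + 1)) powr (2 / of_nat q)) ^ n) 0 / fact n
    = c_seq q n"
proof -
  define z :: complex where "z = 2 * of_nat n / of_nat q"
  define c :: complex where "c = of_nat (q + 1)"
  have c: "c \<in> \<real>" "0 \<le> Re c" "c \<noteq> 0" by (simp_all add: c_def del: of_nat_Suc)
  have eq: "(((\<Sum>k=0..q. w ^ k) / c) powr (2 / of_nat q)) ^ n = c powr (- z) * (\<Sum>k=0..q. w ^ k) powr z"
    if "norm w < 1" for w
  proof -
    define S where "S = (\<Sum>k=0..q. w ^ k)"
    have S: "S \<noteq> 0" using geometric_notin_nonpos_Reals[OF that, of q] by (auto simp: S_def)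
    have "S powr z = (c * (S / c)) powr z" using c by simp
    \<comment> \<open>A positive real factor splits off a principal power without changing the
      branch; the natural exponent \<open>n\<close> below likewise only multiplies the
      logarithm.\<close>
    also have "\<dots> = c powr z * (S / c) powr z" by (rule powr_times_real_left) (use c in auto)
    also have "(S / c) powr z = ((S / c) powr (2 / of_nat q)) ^ n"
      using S c by (simp add: powr_def z_def mult_ac flip: exp_of_nat_mult)
    finally show ?thesis using c by (simp add: S_def powr_minus)
  qed
  have "(deriv ^^ n) (\<lambda>w. (((\<Sum>k=0..q. w ^ k) / c) powr (2 / of_nat q)) ^ n) 0 =
      (deriv ^^ n) (\<lambda>w. c powr (- z) * (\<Sum>k=0..q. w ^ k) powr z) 0"
  proof (intro higher_deriv_cong_ev refl)
    show "\<forall>\<^sub>F w in nhds 0. (((\<Sum>k=0..q. w ^ k) / c) powr (2 / of_nat q)) ^ n =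
        c powr (- z) * (\<Sum>k=0..q. w ^ k) powr z"
      using eventually_nhds_in_open[of "ball 0 1" "0 :: complex"] eq
      by (auto elim!: eventually_mono)
  qed
  also have "\<dots> = c powr (- z) * (deriv ^^ n) (\<lambda>w. (\<Sum>k=0..q. w ^ k) powr z) 0"
    by (rule higher_deriv_cmult[of _ "ball 0 1"])
      (auto intro!: holomorphic_intros simp: geometric_notin_nonpos_Reals)
  finally show ?thesis
    using higher_deriv_geometric_powr[OF assms, of n z]
    by (simp add: c_seq_def c_def z_def field_simps)
qed

text \<open>Logarithmic differentiation. The factor \<open>u\<close> turns
  \<open>k * u ^ (k - 1)\<close> into \<open>k * u ^ k\<close>, and the identity also holds at
  \<open>u = 0\<close>.\<close>

lemma deriv_normalized_geometric:
  fixes u a :: complex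
  assumes "norm u < 1"
  shows "u * deriv (\<lambda>w. ((\<Sum>k=0..q. w ^ k) / of_nat (q + 1)) powr a) u =
    ((\<Sum>k=0..q. u ^ k) / of_nat (q + 1)) powr a *
      (a * ((\<Sum>k=1..q. of_nat k * u ^ k) / (\<Sum>k=0..q. u ^ k)))"
proof -
  define c :: complex where "c = of_nat (q + 1)"
  define S where "S = (\<lambda>w::complex. \<Sum>k=0..q. w ^ k)"
  define D where "D = (\<Sum>k=0..q. of_nat k * u ^ (k - 1))"
  have c: "c \<noteq> 0" by (simp add: c_def del: of_nat_Suc)
  have S: "S u \<noteq> 0" using geometric_notin_nonpos_Reals[OF assms, of q] by (auto simp: S_def)
  have Sc: "S u / c \<notin> \<real>\<^sub>\<le>\<^sub>0"
    using geometric_divide_notin_nonpos_Reals[OF assms, of q] by (simp add: S_def c_def)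
  have "(S has_field_derivative D) (at u)"
    unfolding S_def D_def by (auto intro!: derivative_eq_intros)
  then have "((\<lambda>w. S w / c) has_field_derivative D / c) (at u)"
    by (rule DERIV_cdivide)
  then have "((\<lambda>w. (S w / c) powr a) has_field_derivative a * (S u / c) powr (a - 1) * (D / c)) (at u)"
    by (rule DERIV_chain2[where g = "\<lambda>w. S w / c", OF has_field_derivative_powr[OF Sc]])
  also have "a * (S u / c) powr (a - 1) * (D / c) = (S u / c) powr a * (a * (D / S u))"
    using c S by (simp add: powr_diff)
  finally have "((\<lambda>w. (S w / c) powr a) has_field_derivative (S u / c) powr a * (a * (D / S u))) (at u)" .
  then have "deriv (\<lambda>w. (S w / c) powr a) u = (S u / c) powr a * (a * (D / S u))"
    by (rule DERIV_imp_deriv)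
  moreover have "u * D = (\<Sum>k=1..q. of_nat k * u ^ k)"
  proof -
    have "u * D = (\<Sum>k=0..q. of_nat k * u ^ k)"
      unfolding D_def sum_distrib_left
    proof (intro sum.cong refl)
      fix k show "u * (of_nat k * u ^ (k - 1)) = of_nat k * u ^ k" by (cases k) auto
    qed
    also have "\<dots> = (\<Sum>k=1..q. of_nat k * u ^ k)"
      by (simp add: sum.atLeast_Suc_atMost)
    finally show ?thesis .
  qed
  ultimately show ?thesis
    unfolding S_def c_def by (simp add: mult_ac)
qed


section \<open>The generating function\<close>

text \<open>The symmetric forms involve negative powers of \<open>u\<close>, hence
  \<open>t \<noteq> 0\<close>. Their equation for \<open>t\<close> is multivalued: a principal power
  with exponent \<open>2 / q\<close> has argument in the stated range, so only there can it return
  \<open>t\<close>.\<close>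

theorem theorem11:
  fixes q :: nat
  assumes "q > 0" and "even q"
  shows "\<forall>t::complex. norm t < 1 \<longrightarrow>
    (\<exists>!u. norm u < 1 \<and>
       t = u * (of_nat (q + 1) / (\<Sum>k=0..q. u ^ k)) powr (2 / of_nat q)) \<and>
    summable (\<lambda>n. t ^ n * c_seq q n) \<and>
    (\<forall>u. norm u < 1 \<and>
       t = u * (of_nat (q + 1) / (\<Sum>k=0..q. u ^ k)) powr (2 / of_nat q) \<longrightarrow>
         (\<Sum>k=0..q. u ^ k) \<noteq> 0 \<and>
         1 - 2 / of_nat q * ((\<Sum>k=1..q. of_nat k * u ^ k) / (\<Sum>k=0..q. u ^ k)) \<noteq> 0 \<and>
         G q t = inverse (1 - 2 / of_nat q *
                   ((\<Sum>k=1..q. of_nat k * u ^ k) / (\<Sum>k=0..q. u ^ k))) \<and>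
         (t \<noteq> 0 \<longrightarrow>
            u \<noteq> 0 \<and>
            1 + (\<Sum>k=1..q div 2. u powi (- int k) + u ^ k) \<noteq> 0 \<and>
            (\<Sum>k=1..q div 2. of_nat k * (u powi (- int k) - u ^ k)) \<noteq> 0 \<and>
            G q t = of_nat q / 2 *
              ((1 + (\<Sum>k=1..q div 2. u powi (- int k) + u ^ k)) /
               (\<Sum>k=1..q div 2. of_nat k * (u powi (- int k) - u ^ k))) \<and>
            t \<in> power_values
                  (of_nat (q + 1) / (1 + (\<Sum>k=1..q div 2. u powi (- int k) + u ^ k)))
                  (2 / of_nat q) \<and>
            (- (2 * pi / real q) < Arg t \<and> Arg t \<le> 2 * pi / real q \<longrightarrow>
               t = (of_nat (q + 1) / (1 + (\<Sum>k=1..q div 2. u powi (- int k) + u ^ k)))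
                     powr (2 / of_nat q))))"
proof (intro allI impI conjI)
  fix t :: complex assume t: "norm t < 1"
  define p where "p = q div 2"
  have q: "q = 2 * p" and p: "p > 0" using assms by (auto simp: p_def)
  define c :: complex where "c = of_nat (q + 1)"
  define a :: complex where "a = 2 / of_nat q"
  define S where "S = (\<lambda>w::complex. \<Sum>k=0..q. w ^ k)"
  define \<phi> where "\<phi> = (\<lambda>w. (S w / c) powr a)"
  have c: "c \<noteq> 0" by (simp add: c_def del: of_nat_Suc)
  have a: "a = of_real (2 / real q)" by (simp add: a_def)
  have a_p: "a * of_nat p = 1" using p by (simp add: a_def q)
  have Sc: "S w / c \<notin> \<real>\<^sub>\<le>\<^sub>0" if "norm w < 1" for w
    using geometric_divide_notin_nonpos_Reals[OF that, of q] by (simp add: S_def c_def)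
  have S0: "S w \<noteq> 0" if "norm w < 1" for w
    using Sc[OF that] by auto
  have holo: "\<phi> holomorphic_on ball 0 1"
    unfolding \<phi>_def using Sc by (intro holomorphic_intros) (auto simp: S_def c intro!: holomorphic_intros)
  have le: "norm (\<phi> w) \<le> 1" if "norm w < 1" for w
    using norm_normalized_geometric_le[OF that, of "2 / real q" q]
    unfolding \<phi>_def a S_def c_def by simp
  have \<phi>0: "\<phi> w \<noteq> 0" if "norm w < 1" for w
    using S0[OF that] c by (simp add: \<phi>_def)
  \<comment> \<open>Off the nonpositive reals the principal logarithm of an inverse is the negated
    logarithm, so both forms of the equation use the same branch.\<close>
  have inv: "(c / S w) powr a = inverse (\<phi> w)" if "norm w < 1" for w
  proof -
    have "Ln (c / S w) = - Ln (S w / c)" using Ln_inverse[OF Sc[OF that]] by simp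
    then show ?thesis using S0[OF that] c by (simp add: \<phi>_def powr_def exp_minus)
  qed
  have eqv: "t = w * (c / S w) powr a \<longleftrightarrow> w = t * \<phi> w" if "norm w < 1" for w
    using \<phi>0[OF that] by (auto simp: inv[OF that] field_simps)
  have coeff: "(deriv ^^ n) (\<lambda>w. \<phi> w ^ n) 0 / fact n = c_seq q n" for n
    using higher_deriv_normalized_geometric[OF assms(1), of n]
    unfolding \<phi>_def S_def c_def a_def .
  have sums: "1 - t * deriv \<phi> u \<noteq> 0" "(\<lambda>n. t ^ n * c_seq q n) sums inverse (1 - t * deriv \<phi> u)"
    if "norm u < 1" "u = t * \<phi> u" for u
    using lagrange_sums[OF holo le t that] unfolding coeff by auto
  obtain v where v: "norm v < 1" "v = t * \<phi> v"
    "\<And>w. norm w < 1 \<Longrightarrow> w = t * \<phi> w \<Longrightarrow> w = v"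
    using fixed_point_simple[OF holo le t] by metis
  show "\<exists>!u. norm u < 1 \<and> t = u * (of_nat (q + 1) / (\<Sum>k=0..q. u ^ k)) powr (2 / of_nat q)"
    unfolding c_def[symmetric] a_def[symmetric] fun_cong[OF S_def, symmetric]
  proof (intro ex1I[of _ v] conjI)
    show "t = v * (c / S v) powr a" using v(2) unfolding eqv[OF v(1)] .
    show "w = v" if "norm w < 1 \<and> t = w * (c / S w) powr a" for w
      using that eqv v(3) by blast
  qed (rule v(1))
  show "summable (\<lambda>n. t ^ n * c_seq q n)"
    using sums(2)[OF v(1,2)] by (rule sums_summable)

  fix u
  assume "norm u < 1 \<and> t = u * (of_nat (q + 1) / (\<Sum>k=0..q. u ^ k)) powr (2 / of_nat q)"
  then have u: "norm u < 1" and tu: "t = u * (c / S u) powr a"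
    by (simp_all add: c_def a_def S_def)
  from tu have ut: "u = t * \<phi> u" unfolding eqv[OF u] .
  define E where "E = (\<Sum>k=1..q. of_nat k * u ^ k)"
  have "u * deriv \<phi> u = \<phi> u * (a * (E / S u))"
    using deriv_normalized_geometric[OF u, of q a] unfolding \<phi>_def S_def c_def E_def .
  \<comment> \<open>Replacing \<open>u\<close> by \<open>t * \<phi> u\<close> allows cancelling
    \<open>\<phi> u\<close>, which is never zero; dividing by \<open>u\<close> would exclude
    \<open>t = 0\<close>.\<close>
  moreover have "u * deriv \<phi> u = \<phi> u * (t * deriv \<phi> u)"
    by (subst ut) (simp only: mult_ac)
  ultimately have der: "t * deriv \<phi> u = a * (E / S u)"
    using \<phi>0[OF u] by (metis mult_left_cancel)
  show "(\<Sum>k=0..q. u ^ k) \<noteq> 0" using S0[OF u] by (simp add: S_def)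
  have nz: "1 - a * (E / S u) \<noteq> 0" using sums(1)[OF u ut] der by simp
  then show "1 - 2 / of_nat q * ((\<Sum>k=1..q. of_nat k * u ^ k) / (\<Sum>k=0..q. u ^ k)) \<noteq> 0"
    by (simp add: a_def E_def S_def)
  have G: "G q t = inverse (1 - a * (E / S u))"
    using sums_unique[OF sums(2)[OF u ut]] der by (simp add: G_def)
  then show "G q t = inverse (1 - 2 / of_nat q * ((\<Sum>k=1..q. of_nat k * u ^ k) / (\<Sum>k=0..q. u ^ k)))"
    by (simp add: a_def E_def S_def)

  assume t0: "t \<noteq> 0"
  then show u0: "u \<noteq> 0" using tu by auto
  define T where "T = 1 + (\<Sum>k=1..q div 2. u powi (- int k) + u ^ k)"
  define D where "D = (\<Sum>k=1..q div 2. of_nat k * (u powi (- int k) - u ^ k))"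
  have T: "u ^ p * T = S u"
    using power_mult_symmetric_sum[OF u0, of p] by (simp add: T_def S_def q)
  have "u ^ p * D = (\<Sum>k=0..q. (of_nat p - of_nat k) * u ^ k)"
    using power_mult_antisymmetric_sum[OF u0, of p] by (simp add: D_def q)
  also have "\<dots> = of_nat p * S u - (\<Sum>k=0..q. of_nat k * u ^ k)"
    by (simp add: left_diff_distrib sum_subtractf sum_distrib_left S_def)
  also have "(\<Sum>k=0..q. of_nat k * u ^ k) = E"
    by (simp add: sum.atLeast_Suc_atMost E_def)
  \<comment> \<open>By \<open>a * p = 1\<close>, the difference \<open>p * S u - E\<close> contains
    the very factor whose inverse is \<open>G q t\<close>.\<close>
  finally have D: "u ^ p * D = of_nat p * S u * (1 - a * (E / S u))"
    using a_p S0[OF u] by (simp add: algebra_simps)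
  have T0: "T \<noteq> 0" using T S0[OF u] by auto
  then show "1 + (\<Sum>k=1..q div 2. u powi (- int k) + u ^ k) \<noteq> 0"
    unfolding T_def .
  have D0: "D \<noteq> 0" using D nz S0[OF u] p by auto
  then show "(\<Sum>k=1..q div 2. of_nat k * (u powi (- int k) - u ^ k)) \<noteq> 0"
    unfolding D_def .
  have "u ^ p * D = of_nat p * (u ^ p * T) * (1 - a * (E / S u))"
    using D T by simp
  then have "D = of_nat p * T * (1 - a * (E / S u))" using u0 by simp
  then have "G q t = of_nat p * T / D"
    unfolding G using T0 p by (simp add: inverse_eq_divide)
  then show "G q t = of_nat q / 2 *
              ((1 + (\<Sum>k=1..q div 2. u powi (- int k) + u ^ k)) /
               (\<Sum>k=1..q div 2. of_nat k * (u powi (- int k) - u ^ k)))"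
    unfolding T_def[symmetric] D_def[symmetric] by (simp add: q)
  have cT: "c / T = u ^ p * (c / S u)"
    using u0 unfolding T[symmetric] by simp
  have cS: "c / S u \<noteq> 0" using c S0[OF u] by simp
  \<comment> \<open>A logarithm of \<open>c / T = u ^ p * (c / S u)\<close>, not necessarily the
    principal one, chosen so that \<open>a * l\<close> has the term \<open>Ln u\<close> and
    exponentiates to \<open>t\<close>.\<close>
  define l where "l = of_nat p * Ln u + Ln (c / S u)"
  have "exp l = c / T"
    using u0 cS unfolding cT by (simp add: l_def exp_add exp_of_nat_mult)
  moreover have "a * l = Ln u + a * Ln (c / S u)"
    using a_p by (simp add: l_def distrib_left flip: mult.assoc)
  then have "exp (a * l) = t"
    unfolding tu using u0 cS by (simp add: exp_add powr_def)
  ultimately show "t \<in> power_values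
      (of_nat (q + 1) / (1 + (\<Sum>k=1..q div 2. u powi (- int k) + u ^ k))) (2 / of_nat q)"
    unfolding power_values_def T_def[symmetric] c_def[symmetric] a_def[symmetric] by blast
  assume Arg: "- (2 * pi / real q) < Arg t \<and> Arg t \<le> 2 * pi / real q"
  have "exp (of_nat p * Ln t) = c / T"
  proof -
    have "exp (of_nat p * Ln t) = t ^ p" using t0 by (simp add: exp_of_nat_mult)
    also have "\<dots> = exp (a * l) ^ p" using \<open>exp (a * l) = t\<close> by simp
    also have "\<dots> = exp (a * of_nat p * l)" by (simp add: mult_ac flip: exp_of_nat_mult)
    finally show ?thesis using a_p \<open>exp l = c / T\<close> by simp
  qed
  \<comment> \<open>As \<open>q = 2 * p\<close>, the bound on \<open>Arg t\<close> puts the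
    imaginary part of \<open>p * Ln t\<close> in the half-open interval from \<open>-pi\<close> to
    \<open>pi\<close>, so this logarithm of \<open>c / T\<close> is the principal one.\<close>
  then have "Ln (c / T) = of_nat p * Ln t"
  proof (rule Ln_unique)
    show "- pi < Im (of_nat p * Ln t)" "Im (of_nat p * Ln t) \<le> pi"
      using Arg t0 p by (simp_all add: Arg_eq_Im_Ln q field_simps)
  qed
  then have "(c / T) powr a = exp (a * of_nat p * Ln t)"
    using c T0 by (simp add: powr_def mult.assoc)
  then show "t = (of_nat (q + 1) / (1 + (\<Sum>k=1..q div 2. u powi (- int k) + u ^ k)))
                     powr (2 / of_nat q)"
    unfolding T_def[symmetric] c_def[symmetric] a_def[symmetric] a_p using t0 by simp
qed

end
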